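(* Let $X$ and $Y$ be Banach spaces. Then $Z=X\oplus_\infty Y$ has the Ball Dentable Property ($BDP$) if and only if both $X$ and $Y$ have $BDP$.
   Context: Banach spaces $X,Y$ are real and nontrivial; $B_X$ is the closed unit ball of $X$. $X\oplus_\infty Y$ is $X\times Y$ with norm $\|(x,y)\|=\max\{\|x\|,\|y\|\}$. A slice of $B_X$ is a set $S(B_X,x^*,\alpha)=\{x\in B_X: x^*(x)>\sup x^*(B_X)-\alpha\}$ with $x^*\in X^*$, $\|x^*\|=1$, $\alpha>0$. $X$ has $BDP$ if $B_X$ has slices of arbitrarily small diameter (for every $\varepsilon>0$ there is a slice of $B_X$ of diameter less than $\varepsilon$). *)

theory Defs
  imports "HOL-Analysis.Analysis"
begin

text \<open>
  The library norms the product type by the Euclidean combination of the two norms.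
  The max-norm sum of two normed spaces therefore needs a type of its own.
\<close>

datatype ('a, 'b) linf_sum (infixr "\<oplus>\<^sub>\<infinity>" 20) =
  LInf (linf_fst: 'a) (linf_snd: 'b)

instantiation linf_sum :: (real_normed_vector, real_normed_vector) real_normed_vector
begin

definition zero_linf_sum :: "'a \<oplus>\<^sub>\<infinity> 'b"
  where "0 = LInf 0 0"

definition plus_linf_sum :: "'a \<oplus>\<^sub>\<infinity> 'b \<Rightarrow> 'a \<oplus>\<^sub>\<infinity> 'b \<Rightarrow> 'a \<oplus>\<^sub>\<infinity> 'b"
  where "z + w = LInf (linf_fst z + linf_fst w) (linf_snd z + linf_snd w)"

definition minus_linf_sum :: "'a \<oplus>\<^sub>\<infinity> 'b \<Rightarrow> 'a \<oplus>\<^sub>\<infinity> 'b \<Rightarrow> 'a \<oplus>\<^sub>\<infinity> 'b"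
  where "z - w = LInf (linf_fst z - linf_fst w) (linf_snd z - linf_snd w)"

definition uminus_linf_sum :: "'a \<oplus>\<^sub>\<infinity> 'b \<Rightarrow> 'a \<oplus>\<^sub>\<infinity> 'b"
  where "- z = LInf (- linf_fst z) (- linf_snd z)"

definition scaleR_linf_sum :: "real \<Rightarrow> 'a \<oplus>\<^sub>\<infinity> 'b \<Rightarrow> 'a \<oplus>\<^sub>\<infinity> 'b"
  where "r *\<^sub>R z = LInf (r *\<^sub>R linf_fst z) (r *\<^sub>R linf_snd z)"

definition norm_linf_sum :: "'a \<oplus>\<^sub>\<infinity> 'b \<Rightarrow> real"
  where "norm z = max (norm (linf_fst z)) (norm (linf_snd z))"

definition dist_linf_sum :: "'a \<oplus>\<^sub>\<infinity> 'b \<Rightarrow> 'a \<oplus>\<^sub>\<infinity> 'b \<Rightarrow> real"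
  where "dist z w = norm (z - w)" for z w :: "'a \<oplus>\<^sub>\<infinity> 'b"

definition sgn_linf_sum :: "'a \<oplus>\<^sub>\<infinity> 'b \<Rightarrow> 'a \<oplus>\<^sub>\<infinity> 'b"
  where "sgn z = inverse (norm z) *\<^sub>R z" for z :: "'a \<oplus>\<^sub>\<infinity> 'b"

definition uniformity_linf_sum :: "(('a \<oplus>\<^sub>\<infinity> 'b) \<times> ('a \<oplus>\<^sub>\<infinity> 'b)) filter"
  where [code del]: "uniformity_linf_sum = (INF e\<in>{0 <..}. principal {(z, w). dist z w < e})"

definition open_linf_sum :: "('a \<oplus>\<^sub>\<infinity> 'b) set \<Rightarrow> bool"
  where [code del]: "open_linf_sum S = (\<forall>z\<in>S. \<forall>\<^sub>F (z', w) in uniformity. z' = z \<longrightarrow> w \<in> S)"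

instance
proof
  fix z w :: "'a \<oplus>\<^sub>\<infinity> 'b" and r :: real
  show "norm (z + w) \<le> norm z + norm w"
    using norm_triangle_ineq[of "linf_fst z" "linf_fst w"]
      norm_triangle_ineq[of "linf_snd z" "linf_snd w"]
    unfolding norm_linf_sum_def plus_linf_sum_def linf_sum.sel by linarith
  show "norm (r *\<^sub>R z) = \<bar>r\<bar> * norm z"
    by (simp add: norm_linf_sum_def scaleR_linf_sum_def max_mult_distrib_left)
  show "(norm z = 0) = (z = 0)"
    by (cases z) (auto simp: norm_linf_sum_def zero_linf_sum_def max_def split: if_splits)
qed (auto simp: zero_linf_sum_def plus_linf_sum_def minus_linf_sum_def uminus_linf_sum_def
      scaleR_linf_sum_def dist_linf_sum_def sgn_linf_sum_def uniformity_linf_sum_def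
      open_linf_sum_def algebra_simps intro: linf_sum.expand)

end

lemma dist_linf_sum:
  "dist z w = max (dist (linf_fst z) (linf_fst w)) (dist (linf_snd z) (linf_snd w))"
  by (simp add: dist_norm norm_linf_sum_def minus_linf_sum_def)

instance linf_sum :: (banach, banach) banach
proof
  fix X :: "nat \<Rightarrow> 'a \<oplus>\<^sub>\<infinity> 'b"
  assume "Cauchy X"
  then have "Cauchy (\<lambda>n. linf_fst (X n))" "Cauchy (\<lambda>n. linf_snd (X n))"
    unfolding Cauchy_def dist_linf_sum max_less_iff_conj by blast+
  then obtain a b where a: "(\<lambda>n. linf_fst (X n)) \<longlonglongrightarrow> a" and b: "(\<lambda>n. linf_snd (X n)) \<longlonglongrightarrow> b"
    by (auto simp: Cauchy_convergent_iff convergent_def)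
  have "X \<longlonglongrightarrow> LInf a b"
    unfolding tendsto_iff
  proof (intro allI impI)
    fix e :: real
    assume "e > 0"
    with a b show "\<forall>\<^sub>F n in sequentially. dist (X n) (LInf a b) < e"
      by (auto simp: tendsto_iff dist_linf_sum intro: eventually_conj)
  qed
  then show "convergent X"
    by (auto simp: convergent_def)
qed

definition slice :: "'a::real_normed_vector set \<Rightarrow> ('a \<Rightarrow>\<^sub>L real) \<Rightarrow> real \<Rightarrow> 'a set"
  where "slice C f \<alpha> = {x \<in> C. blinfun_apply f x > (SUP y\<in>C. blinfun_apply f y) - \<alpha>}"

definition BDP :: "'a::real_normed_vector itself \<Rightarrow> bool"
  where "BDP TYPE('a) \<longleftrightarrow>
    (\<forall>\<epsilon>>0. \<exists>(f :: 'a \<Rightarrow>\<^sub>L real) \<alpha>. norm f = 1 \<and> \<alpha> > 0 \<and> diameter (slice (cball 0 1) f \<alpha>) < \<epsilon>)"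

end

theory Submission
  imports Defs
begin

text \<open>
  The dual of the max-norm sum is the sum of the duals with norm
  \<open>\<parallel>f\<parallel> + \<parallel>g\<parallel>\<close>. A functional \<open>f + g\<close> on the sum is therefore almost maximal at \<open>(x, y)\<close>
  exactly when \<open>f\<close> is almost maximal at \<open>x\<close> and \<open>g\<close> is almost maximal at \<open>y\<close>. Consequently
  a slice of the ball of the sum contains translated copies of slices of the balls
  of the summands (\<open>BDP_of_max_norm_summand\<close>), and conversely the product of two slices
  of those balls contains a slice of the ball of the sum (\<open>BDP_linf_sum\<close>). Since the distance
  in the sum is the maximum of the two distances, diameters pass both ways.

  The only danger is a functional that vanishes on one summand: every slice it determines contains
  a copy of the whole ball of that summand. That ball has diameter at least 2 because the
  summand is nontrivial, so such a functional is excluded by considering only slices of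
  diameter less than 1.
\<close>

lemma blinfun_apply_le_norm:
  fixes f :: "'a::real_normed_vector \<Rightarrow>\<^sub>L real"
  assumes "norm x \<le> 1"
  shows "blinfun_apply f x \<le> norm f"
proof -
  have "blinfun_apply f x \<le> norm f * norm x"
    using norm_blinfun[of f x] by simp
  also have "\<dots> \<le> norm f"
    using assms by (simp add: mult_left_le)
  finally show ?thesis .
qed

lemma blinfun_norm_le_if_cball:
  fixes f :: "'a::real_normed_vector \<Rightarrow>\<^sub>L real"
  assumes bound: "\<And>x. norm x \<le> 1 \<Longrightarrow> blinfun_apply f x \<le> c"
  shows "norm f \<le> c"
proof (rule norm_blinfun_bound)
  show "0 \<le> c"
    using bound[of 0] by simp
next
  fix x :: 'a
  show "norm (blinfun_apply f x) \<le> c * norm x"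
  proof (cases "x = 0")
    case False
    have "blinfun_apply f (s *\<^sub>R x /\<^sub>R norm x) \<le> c" if "\<bar>s\<bar> = 1" for s
      using that False by (intro bound) (simp add: abs_mult)
    from this[of 1] this[of "-1"] show ?thesis
      using False by (simp add: blinfun.scaleR_right blinfun.minus_right field_simps abs_le_iff)
  qed simp
qed

lemma SUP_blinfun_cball:
  fixes f :: "'a::real_normed_vector \<Rightarrow>\<^sub>L real"
  shows "(SUP x\<in>cball 0 1. blinfun_apply f x) = norm f"
proof (rule antisym)
  show "(SUP x\<in>cball 0 1. blinfun_apply f x) \<le> norm f"
    by (rule cSUP_least) (auto simp: blinfun_apply_le_norm)
  have "bdd_above (blinfun_apply f ` cball 0 1)"
    by (rule bdd_aboveI2[where M = "norm f"]) (simp add: blinfun_apply_le_norm)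
  then show "norm f \<le> (SUP x\<in>cball 0 1. blinfun_apply f x)"
    by (intro blinfun_norm_le_if_cball cSUP_upper) auto
qed

lemma mem_slice_cball:
  "x \<in> slice (cball 0 1) f \<alpha> \<longleftrightarrow> norm x \<le> 1 \<and> blinfun_apply f x > norm f - \<alpha>"
  by (simp add: slice_def SUP_blinfun_cball)

lemma bounded_slice_cball: "bounded (slice (cball 0 1) f \<alpha>)"
  by (rule bounded_subset[OF bounded_cball[of 0 1]]) (auto simp: slice_def)

lemma slice_cball_nonempty:
  assumes "\<alpha> > 0"
  shows "\<exists>x. x \<in> slice (cball 0 1) f \<alpha>"
proof (rule ccontr)
  assume "\<nexists>x. x \<in> slice (cball 0 1) f \<alpha>"
  then have "norm f \<le> norm f - \<alpha>"
    by (intro blinfun_norm_le_if_cball) (force simp: mem_slice_cball)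
  with assms show False by simp
qed

text \<open>
  Slices of the ball do not change when the functional and the width are multiplied by the same
  positive factor, so the normalisation of the functional may be relaxed to its being nonzero.
\<close>

lemma BDP_iff_nonzero_functional:
  "BDP TYPE('a::real_normed_vector) \<longleftrightarrow>
    (\<forall>\<epsilon>>0. \<exists>(f :: 'a \<Rightarrow>\<^sub>L real) \<alpha>. f \<noteq> 0 \<and> \<alpha> > 0 \<and> diameter (slice (cball 0 1) f \<alpha>) < \<epsilon>)"
proof
  assume "BDP TYPE('a)"
  then show "\<forall>\<epsilon>>0. \<exists>(f :: 'a \<Rightarrow>\<^sub>L real) \<alpha>.
      f \<noteq> 0 \<and> \<alpha> > 0 \<and> diameter (slice (cball 0 1) f \<alpha>) < \<epsilon>"
    unfolding BDP_def by (metis norm_zero zero_neq_one)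
next
  assume nonzero: "\<forall>\<epsilon>>0. \<exists>(f :: 'a \<Rightarrow>\<^sub>L real) \<alpha>.
      f \<noteq> 0 \<and> \<alpha> > 0 \<and> diameter (slice (cball 0 1) f \<alpha>) < \<epsilon>"
  show "BDP TYPE('a)"
    unfolding BDP_def
  proof (intro allI impI)
    fix \<epsilon> :: real
    assume "\<epsilon> > 0"
    with nonzero obtain f :: "'a \<Rightarrow>\<^sub>L real" and \<alpha>
      where f: "f \<noteq> 0" "\<alpha> > 0" "diameter (slice (cball 0 1) f \<alpha>) < \<epsilon>"
      by blast
    have "slice (cball 0 1) (f /\<^sub>R norm f) (\<alpha> / norm f) = slice (cball 0 1) f \<alpha>"
    proof -
      have "blinfun_apply f x / norm f > 1 - \<alpha> / norm f \<longleftrightarrow> blinfun_apply f x > norm f - \<alpha>" for x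
        using f(1) divide_less_cancel[of "norm f - \<alpha>" "norm f" "blinfun_apply f x"]
        by (simp add: diff_divide_distrib)
      then show ?thesis
        using f(1) by (simp add: set_eq_iff mem_slice_cball blinfun.scaleR_left divide_inverse_commute)
    qed
    moreover have "norm (f /\<^sub>R norm f) = 1" "\<alpha> / norm f > 0"
      using f by auto
    ultimately show "\<exists>(f :: 'a \<Rightarrow>\<^sub>L real) \<alpha>.
        norm f = 1 \<and> \<alpha> > 0 \<and> diameter (slice (cball 0 1) f \<alpha>) < \<epsilon>"
      using f(3) by metis
  qed
qed

text \<open>
  Fix a point of the ball of the second summand at which the functional is almost maximal. Adding
  this point embeds a slice of the ball of the first summand isometrically into the given slice.
  The decomposition is given by two embeddings rather than by the type of max-norm sums, so that
  the statement applies to either summand.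
\<close>

lemma BDP_of_max_norm_summand:
  fixes i :: "'a::real_normed_vector \<Rightarrow> 'c::real_normed_vector"
    and j :: "'b::real_normed_vector \<Rightarrow> 'c"
  assumes i: "bounded_linear i" and j: "bounded_linear j"
    and norm_sum: "\<And>x y. norm (i x + j y) = max (norm x) (norm y)"
    and decomp: "\<And>z. \<exists>x y. z = i x + j y"
    and nontrivial: "\<exists>x :: 'a. x \<noteq> 0"
    and BDP: "BDP TYPE('c)"
  shows "BDP TYPE('a)"
  unfolding BDP_iff_nonzero_functional
proof (intro allI impI)
  fix \<epsilon> :: real
  assume "\<epsilon> > 0"
  then have "min \<epsilon> 1 > 0" by simp
  with BDP obtain h :: "'c \<Rightarrow>\<^sub>L real" and \<alpha>
    where \<alpha>: "\<alpha> > 0" and diam: "diameter (slice (cball 0 1) h \<alpha>) < min \<epsilon> 1"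
    unfolding BDP_def by blast
  define f where "f = h o\<^sub>L Blinfun i"
  define g where "g = h o\<^sub>L Blinfun j"
  have f_apply: "blinfun_apply f x = blinfun_apply h (i x)" for x
    by (simp add: f_def bounded_linear_Blinfun_apply[OF i])
  have g_apply: "blinfun_apply g y = blinfun_apply h (j y)" for y
    by (simp add: g_def bounded_linear_Blinfun_apply[OF j])
  have norm_h: "norm h \<le> norm f + norm g"
  proof (rule blinfun_norm_le_if_cball)
    fix z :: 'c
    assume "norm z \<le> 1"
    moreover obtain x y where z: "z = i x + j y"
      using decomp by blast
    ultimately have "norm x \<le> 1" "norm y \<le> 1"
      by (simp_all add: norm_sum)
    then have "blinfun_apply f x \<le> norm f" "blinfun_apply g y \<le> norm g"
      by (simp_all add: blinfun_apply_le_norm)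
    then show "blinfun_apply h z \<le> norm f + norm g"
      by (simp add: z blinfun.add_right f_apply g_apply)
  qed
  obtain y where y: "y \<in> slice (cball 0 1) g (\<alpha> / 2)"
    using slice_cball_nonempty[of "\<alpha> / 2" g] \<alpha> by auto
  have embed: "i x + j y \<in> slice (cball 0 1) h \<alpha>" if "x \<in> slice (cball 0 1) f (\<alpha> / 2)" for x
    using that y norm_h
    by (auto simp: mem_slice_cball norm_sum blinfun.add_right f_apply g_apply)
  have dist_embed: "dist (i x + j y) (i x' + j y) = dist x x'" for x x'
    using norm_sum[of "x - x'" 0]
    by (simp add: dist_norm linear_diff linear_0 bounded_linear.linear[OF i] bounded_linear.linear[OF j])
  have dist_le: "dist x x' \<le> diameter (slice (cball 0 1) h \<alpha>)"
    if "x \<in> slice (cball 0 1) f (\<alpha> / 2)" "x' \<in> slice (cball 0 1) f (\<alpha> / 2)" for x x'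
    using diameter_bounded_bound[OF bounded_slice_cball embed[OF that(1)] embed[OF that(2)]]
    by (simp only: dist_embed)
  have "f \<noteq> 0"
  proof
    assume "f = 0"
    obtain x :: 'a where "x \<noteq> 0"
      using nontrivial by blast
    define u where "u = x /\<^sub>R norm x"
    have u: "norm u = 1"
      using \<open>x \<noteq> 0\<close> by (simp add: u_def)
    then have "u \<in> slice (cball 0 1) f (\<alpha> / 2)" "- u \<in> slice (cball 0 1) f (\<alpha> / 2)"
      using \<alpha> \<open>f = 0\<close> by (simp_all add: mem_slice_cball)
    from dist_le[OF this] diam have "dist u (- u) < 1"
      by simp
    moreover have "dist u (- u) = 2"
      using u by (simp add: dist_norm scaleR_2[symmetric])
    ultimately show False by simp
  qed
  moreover have "diameter (slice (cball 0 1) f (\<alpha> / 2)) \<le> diameter (slice (cball 0 1) h \<alpha>)"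
    using slice_cball_nonempty[of "\<alpha> / 2" f] \<alpha> dist_le
    by (intro diameter_le) (auto simp: dist_norm)
  ultimately show "\<exists>(f :: 'a \<Rightarrow>\<^sub>L real) \<alpha>. f \<noteq> 0 \<and> \<alpha> > 0 \<and> diameter (slice (cball 0 1) f \<alpha>) < \<epsilon>"
    using \<alpha> diam by (intro exI[of _ f] exI[of _ "\<alpha> / 2"]) auto
qed

lemma bounded_linear_linf_fst:
  "bounded_linear (linf_fst :: ('a::real_normed_vector, 'b::real_normed_vector) linf_sum \<Rightarrow> 'a)"
  by (rule bounded_linear_intro[where K = 1])
    (simp_all add: plus_linf_sum_def scaleR_linf_sum_def norm_linf_sum_def)

lemma bounded_linear_linf_snd:
  "bounded_linear (linf_snd :: ('a::real_normed_vector, 'b::real_normed_vector) linf_sum \<Rightarrow> 'b)"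
  by (rule bounded_linear_intro[where K = 1])
    (simp_all add: plus_linf_sum_def scaleR_linf_sum_def norm_linf_sum_def)

lemma bounded_linear_LInf_left:
  "bounded_linear (\<lambda>x. LInf x 0 :: ('a::real_normed_vector, 'b::real_normed_vector) linf_sum)"
  by (rule bounded_linear_intro[where K = 1])
    (simp_all add: plus_linf_sum_def scaleR_linf_sum_def norm_linf_sum_def)

lemma bounded_linear_LInf_right:
  "bounded_linear (\<lambda>y. LInf 0 y :: ('a::real_normed_vector, 'b::real_normed_vector) linf_sum)"
  by (rule bounded_linear_intro[where K = 1])
    (simp_all add: plus_linf_sum_def scaleR_linf_sum_def norm_linf_sum_def)

text \<open>
  If \<open>f\<close> and \<open>g\<close> have norm 1, their sum has norm 2, while neither term exceeds 1 on the ball. A point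
  at which the sum is above \<open>2 - \<gamma>\<close> thus has both terms above \<open>1 - \<gamma>\<close>: the slice
  of the sum lies in the product of two slices.
\<close>

lemma BDP_linf_sum:
  assumes "BDP TYPE('a::real_normed_vector)" and "BDP TYPE('b::real_normed_vector)"
  shows "BDP TYPE('a \<oplus>\<^sub>\<infinity> 'b)"
  unfolding BDP_iff_nonzero_functional
proof (intro allI impI)
  fix \<epsilon> :: real
  assume "\<epsilon> > 0"
  with assms obtain f :: "'a \<Rightarrow>\<^sub>L real" and \<alpha> and g :: "'b \<Rightarrow>\<^sub>L real" and \<beta>
    where f: "norm f = 1" "\<alpha> > 0" "diameter (slice (cball 0 1) f \<alpha>) < \<epsilon>"
      and g: "norm g = 1" "\<beta> > 0" "diameter (slice (cball 0 1) g \<beta>) < \<epsilon>"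
    unfolding BDP_def by blast
  define h where "h = (f o\<^sub>L Blinfun linf_fst) + (g o\<^sub>L Blinfun linf_snd)"
  have h_apply: "blinfun_apply h z = blinfun_apply f (linf_fst z) + blinfun_apply g (linf_snd z)" for z
    by (simp add: h_def blinfun.add_left bounded_linear_Blinfun_apply bounded_linear_linf_fst
        bounded_linear_linf_snd)
  have "norm f \<le> norm h - norm g"
  proof (rule blinfun_norm_le_if_cball)
    fix x :: 'a
    assume x: "norm x \<le> 1"
    have "norm g \<le> norm h - blinfun_apply f x"
    proof (rule blinfun_norm_le_if_cball)
      fix y :: 'b
      assume "norm y \<le> 1"
      with x have "blinfun_apply h (LInf x y) \<le> norm h"
        by (intro blinfun_apply_le_norm) (simp add: norm_linf_sum_def)
      then show "blinfun_apply g y \<le> norm h - blinfun_apply f x"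
        by (simp add: h_apply)
    qed
    then show "blinfun_apply f x \<le> norm h - norm g"
      by simp
  qed
  with f g have norm_h: "norm h \<ge> 2"
    by simp
  define \<gamma> where "\<gamma> = min \<alpha> \<beta>"
  have \<gamma>: "\<gamma> > 0" "\<gamma> \<le> \<alpha>" "\<gamma> \<le> \<beta>"
    using f g by (auto simp: \<gamma>_def)
  have product: "linf_fst z \<in> slice (cball 0 1) f \<alpha> \<and> linf_snd z \<in> slice (cball 0 1) g \<beta>"
    if "z \<in> slice (cball 0 1) h \<gamma>" for z
  proof -
    from that have z: "norm (linf_fst z) \<le> 1" "norm (linf_snd z) \<le> 1"
      and "blinfun_apply f (linf_fst z) + blinfun_apply g (linf_snd z) > norm h - \<gamma>"
      by (simp_all add: mem_slice_cball norm_linf_sum_def h_apply)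
    with blinfun_apply_le_norm[OF z(1), of f] blinfun_apply_le_norm[OF z(2), of g]
    show ?thesis
      using norm_h \<gamma> f(1) g(1) by (simp add: mem_slice_cball)
  qed
  let ?d = "max (diameter (slice (cball 0 1) f \<alpha>)) (diameter (slice (cball 0 1) g \<beta>))"
  have "dist z w \<le> ?d" if "z \<in> slice (cball 0 1) h \<gamma>" "w \<in> slice (cball 0 1) h \<gamma>" for z w
    using product[OF that(1)] product[OF that(2)] unfolding dist_linf_sum
    by (intro max.mono diameter_bounded_bound bounded_slice_cball) auto
  then have "diameter (slice (cball 0 1) h \<gamma>) \<le> ?d"
    using slice_cball_nonempty[OF \<gamma>(1), of h] by (intro diameter_le) (auto simp: dist_norm)
  also have "?d < \<epsilon>"
    using f g by simp
  finally show "\<exists>(f :: ('a \<oplus>\<^sub>\<infinity> 'b) \<Rightarrow>\<^sub>L real) \<alpha>. f \<noteq> 0 \<and> \<alpha> > 0 \<and> diameter (slice (cball 0 1) f \<alpha>) < \<epsilon>"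
    using norm_h \<gamma>(1) by (intro exI[of _ h] exI[of _ \<gamma>]) auto
qed

theorem proposition2p7:
  assumes "\<exists>x :: 'a::banach. x \<noteq> 0" and "\<exists>y :: 'b::banach. y \<noteq> 0"
  shows "BDP TYPE('a \<oplus>\<^sub>\<infinity> 'b) \<longleftrightarrow> BDP TYPE('a) \<and> BDP TYPE('b)"
proof
  assume BDP: "BDP TYPE('a \<oplus>\<^sub>\<infinity> 'b)"
  let ?i = "\<lambda>x. LInf x 0 :: 'a \<oplus>\<^sub>\<infinity> 'b" and ?j = "\<lambda>y. LInf 0 y :: 'a \<oplus>\<^sub>\<infinity> 'b"
  have sum: "?i x + ?j y = LInf x y" "?j y + ?i x = LInf x y" for x y
    by (simp_all add: plus_linf_sum_def)
  have decomp: "\<exists>x y. z = LInf x y" for z :: "'a \<oplus>\<^sub>\<infinity> 'b"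
    by (cases z) auto
  have "BDP TYPE('a)"
    using bounded_linear_LInf_left bounded_linear_LInf_right _ _ assms(1) BDP
  proof (rule BDP_of_max_norm_summand)
    show "norm (?i x + ?j y) = max (norm x) (norm y)" for x y
      by (simp add: sum norm_linf_sum_def)
    show "\<exists>x y. z = ?i x + ?j y" for z
      using decomp by (simp add: sum)
  qed
  moreover have "BDP TYPE('b)"
    using bounded_linear_LInf_right bounded_linear_LInf_left _ _ assms(2) BDP
  proof (rule BDP_of_max_norm_summand)
    show "norm (?j y + ?i x) = max (norm y) (norm x)" for x y
      by (simp add: sum norm_linf_sum_def max.commute)
    show "\<exists>y x. z = ?j y + ?i x" for z
      using decomp[of z] by (auto simp: sum)
  qed
  ultimately show "BDP TYPE('a) \<and> BDP TYPE('b)" ..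
next
  assume "BDP TYPE('a) \<and> BDP TYPE('b)"
  then show "BDP TYPE('a \<oplus>\<^sub>\<infinity> 'b)"
    by (simp add: BDP_linf_sum)
qed

end
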